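(* Let $f$ be a smooth function near $(0,0)$ with $f=x^2+b_0x^3+b_1x^2y+b_2xy^2+b_3y^3+\text{h.o.t.}$ and $b_3\neq0$. The limiting curvature of the level curves $f=k$ is infinite as $k\to0$, at vertices on any of the (three) branches of the vertex set $V_f=0$ through the origin; that is, along each branch, as a point $q\neq(0,0)$ of the branch tends to the origin, the absolute value of the curvature at $q$ of the level curve of $f$ through $q$ tends to infinity.
   Context: The surface $z=f(x,y)$ has an ordinary parabolic point at the origin. The vertex set, i.e. the locus of vertices (critical points of curvature) of the level curves $f=k$, is the zero set of $$\begin{aligned}V_f=&(f_x^2+f_y^2)(-f_y^3f_{xxx}+3f_xf_y^2f_{xxy}-3f_x^2f_yf_{xyy}+f_x^3f_{yyy})\\&+3f_xf_y\big(f_y^2f_{xx}^2+(f_x^2-f_y^2)f_{xx}f_{yy}-f_x^2f_{yy}^2\big)+6f_xf_yf_{xy}^2(f_x^2-f_y^2)\\&+3f_{xy}\big(f_{xx}f_y^4-3f_x^2f_y^2(f_{xx}-f_{yy})-f_{yy}f_x^4\big);\end{aligned}$$ it has three branches through the origin, one smooth and two with ordinary cusps. The curvature $\kappa$ of a level curve of $f$ satisfies $\kappa^2=(f_{xx}f_y^2-2f_{xy}f_xf_y+f_{yy}f_x^2)^2/(f_x^2+f_y^2)^3$. *)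

theory Defs
  imports "HOL-Analysis.Analysis" "HOL-Library.Landau_Symbols"
begin

definition pd_x :: "(real \<times> real \<Rightarrow> real) \<Rightarrow> real \<times> real \<Rightarrow> real"
  where "pd_x f p = deriv (\<lambda>t. f (t, snd p)) (fst p)"

definition pd_y :: "(real \<times> real \<Rightarrow> real) \<Rightarrow> real \<times> real \<Rightarrow> real"
  where "pd_y f p = deriv (\<lambda>t. f (fst p, t)) (snd p)"

text \<open>\<open>C_k_on k U f\<close> is meant for open \<open>U\<close> only.\<close>

primrec C_k_on :: "nat \<Rightarrow> (real \<times> real) set \<Rightarrow> (real \<times> real \<Rightarrow> real) \<Rightarrow> bool" where
  "C_k_on 0 U f \<longleftrightarrow> continuous_on U f"
| "C_k_on (Suc k) U f \<longleftrightarrow>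
     f differentiable_on U \<and> C_k_on k U (pd_x f) \<and> C_k_on k U (pd_y f)"

definition smooth_near :: "(real \<times> real \<Rightarrow> real) \<Rightarrow> real \<times> real \<Rightarrow> bool"
  where "smooth_near f p \<longleftrightarrow> (\<exists>U. open U \<and> p \<in> U \<and> (\<forall>k. C_k_on k U f))"

definition vertex_fun :: "(real \<times> real \<Rightarrow> real) \<Rightarrow> real \<times> real \<Rightarrow> real"
  where "vertex_fun f p =
    (let fx = pd_x f p; fy = pd_y f p;
         fxx = pd_x (pd_x f) p; fxy = pd_y (pd_x f) p; fyy = pd_y (pd_y f) p;
         fxxx = pd_x (pd_x (pd_x f)) p; fxxy = pd_y (pd_x (pd_x f)) p;
         fxyy = pd_y (pd_y (pd_x f)) p; fyyy = pd_y (pd_y (pd_y f)) p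
     in (fx^2 + fy^2) * (- (fy^3 * fxxx) + 3 * fx * fy^2 * fxxy - 3 * fx^2 * fy * fxyy + fx^3 * fyyy)
        + 3 * fx * fy * (fy^2 * fxx^2 + (fx^2 - fy^2) * fxx * fyy - fx^2 * fyy^2)
        + 6 * fx * fy * fxy^2 * (fx^2 - fy^2)
        + 3 * fxy * (fxx * fy^4 - 3 * fx^2 * fy^2 * (fxx - fyy) - fyy * fx^4))"

definition vertex_set :: "(real \<times> real \<Rightarrow> real) \<Rightarrow> (real \<times> real) set"
  where "vertex_set f = {p. vertex_fun f p = 0}"

text \<open>The absolute value of the curvature at \<open>p\<close> of the level curve of \<open>f\<close> through \<open>p\<close>.
  At a critical point of \<open>f\<close>, where the level curve has no curvature, this is \<open>0\<close> because
  of division by zero.\<close>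

definition abs_level_curvature :: "(real \<times> real \<Rightarrow> real) \<Rightarrow> real \<times> real \<Rightarrow> real"
  where "abs_level_curvature f p =
    (let fx = pd_x f p; fy = pd_y f p;
         fxx = pd_x (pd_x f) p; fxy = pd_y (pd_x f) p; fyy = pd_y (pd_y f) p
     in sqrt ((fxx * fy^2 - 2 * fxy * fx * fy + fyy * fx^2)^2 / (fx^2 + fy^2)^3))"

definition smooth_curve_on :: "real set \<Rightarrow> (real \<Rightarrow> real \<times> real) \<Rightarrow> bool"
  where "smooth_curve_on I \<gamma> \<longleftrightarrow>
    (\<forall>k. \<forall>t\<in>I. (deriv ^^ k) (\<lambda>s. fst (\<gamma> s)) field_differentiable at t \<and>
               (deriv ^^ k) (\<lambda>s. snd (\<gamma> s)) field_differentiable at t)"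

definition curve_deriv :: "nat \<Rightarrow> (real \<Rightarrow> real \<times> real) \<Rightarrow> real \<Rightarrow> real \<times> real"
  where "curve_deriv k \<gamma> t =
    ((deriv ^^ k) (\<lambda>s. fst (\<gamma> s)) t, (deriv ^^ k) (\<lambda>s. snd (\<gamma> s)) t)"

definition ordinary_cusp_at :: "(real \<Rightarrow> real \<times> real) \<Rightarrow> real \<Rightarrow> bool"
  where "ordinary_cusp_at \<gamma> t \<longleftrightarrow> curve_deriv 1 \<gamma> t = 0 \<and>
    fst (curve_deriv 2 \<gamma> t) * snd (curve_deriv 3 \<gamma> t)
      - snd (curve_deriv 2 \<gamma> t) * fst (curve_deriv 3 \<gamma> t) \<noteq> 0"

text \<open>\<open>\<gamma>\<close> parametrizes (with parameter value \<open>0\<close> at the origin) a branch of the vertex set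
  through the origin: a smooth curve germ contained in the vertex set that is either
  regular at the origin or has an ordinary cusp there.\<close>

definition vertex_branch :: "(real \<times> real \<Rightarrow> real) \<Rightarrow> (real \<Rightarrow> real \<times> real) \<Rightarrow> bool"
  where "vertex_branch f \<gamma> \<longleftrightarrow>
    \<gamma> 0 = (0, 0) \<and>
    (\<exists>\<epsilon>>0. smooth_curve_on {-\<epsilon><..<\<epsilon>} \<gamma> \<and> \<gamma> ` {-\<epsilon><..<\<epsilon>} \<subseteq> vertex_set f) \<and>
    (curve_deriv 1 \<gamma> 0 \<noteq> 0 \<or> ordinary_cusp_at \<gamma> 0)"

end

theory Submission imports Defs begin

text \<open>The two cusps of the vertex set have the shape $x^2 \sim y^3$, so the right way to measure smallness
is the scale $s$ with $\max(|x|/s^3, |y|/s^2) = 1$: write $x = \xi s^3$ and $y = \eta s^2$ with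
$(\xi,\eta)$ on the boundary of the unit square. In these coordinates
$f_x = s^3 (a + o(1))$ and $f_y = s^4 (c + o(1))$ with $a = 2\xi$, $c = 3 b_3 \eta^2$, while
$f_{xx} \to 2$, $f_{xy} = o(s)$, $f_{yy} = s^2 (6 b_3 \eta + o(1))$ and $f_{yyy} \to 6 b_3$.
Consequently
\<^item> $V_f = s^{15} \cdot (6 b_3\, a\, (a^4 + 18 b_3 \eta^3 a^2 + 54 b_3^2 \eta^6) + o(1))$,
\<^item> the numerator $f_{xx}f_y^2 - 2f_{xy}f_xf_y + f_{yy}f_x^2$ of the curvature is
  $s^8 \cdot (6 b_3 \eta\, (a^2 + 3 b_3 \eta^3) + o(1))$,
\<^item> its denominator $(f_x^2 + f_y^2)^{3/2}$ is $O(s^9)$.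

The two leading forms have no common zero besides the origin: for $\eta = 0$ the first one is
$6 b_3 a^5$; for $\eta \neq 0$ the second one vanishes only where $a^2 = -3 b_3 \eta^3 \neq 0$, and there
the quartic factor of the first one equals $9 b_3^2 \eta^6$. So on the vertex set, where the first form
tends to zero, compactness keeps the second one away from zero, and the curvature grows at least like
$1/s$. This covers all branches at once, without parametrizing them: a branch, being regular or an
ordinary cusp, leaves the origin immediately and inside the vertex set, so the limit along the
vertex set can be composed with it.

The expansions of the partial derivatives come from the cubic jet of $f$. An estimate
$f - Q = O(r^{m+1})$ with $m \le 3$, for a smooth $f$ and a cubic polynomial $Q$, may be differentiated along an axis, with
loss of one power of $r$: the four-point forward difference with step proportional to $r$ is exact
on cubic polynomials and reproduces the derivative of $f$ up to $O(r^3)$.\<close>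

section \<open>Partial derivatives of smooth functions of two variables\<close>

definition C_inf_on :: "(real \<times> real) set \<Rightarrow> (real \<times> real \<Rightarrow> real) \<Rightarrow> bool"
  where "C_inf_on U f \<longleftrightarrow> (\<forall>k. C_k_on k U f)"

lemma C_inf_on_pd_x: "C_inf_on U f \<Longrightarrow> C_inf_on U (pd_x f)"
  and C_inf_on_pd_y: "C_inf_on U f \<Longrightarrow> C_inf_on U (pd_y f)"
  unfolding C_inf_on_def by (metis C_k_on.simps(2))+

lemma C_inf_on_differentiable:
  assumes "C_inf_on U f" "open U" "p \<in> U"
  shows "f differentiable (at p)"
proof -
  have "C_k_on (Suc 0) U f" using assms(1) by (simp add: C_inf_on_def)
  then have "f differentiable (at p within U)"
    using assms(3) by (simp add: differentiable_on_def)
  then show ?thesis using assms(2,3) by (simp add: at_within_open[of p U])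
qed

lemma C_inf_on_isCont:
  assumes "C_inf_on U f" "open U" "p \<in> U"
  shows "isCont f p"
  using C_inf_on_differentiable[OF assms] by (rule differentiable_imp_continuous_within)

lemma has_real_derivative_pd_x:
  assumes "f differentiable (at p)"
  shows "((\<lambda>t. f (p + t *\<^sub>R (1, 0))) has_real_derivative pd_x f p) (at 0)"
proof -
  obtain f' where f': "(f has_derivative f') (at p)"
    using assms by (auto simp: differentiable_def)
  have "((\<lambda>t. f (t, snd p)) has_derivative (\<lambda>t. f' (t, 0))) (at (fst p))"
    using has_derivative_compose[of "\<lambda>t. (t, snd p)" "\<lambda>t. (t, 0)" "fst p" UNIV f f'] f'
    by (simp add: has_derivative_Pair)
  then have "(\<lambda>t. f (t, snd p)) differentiable (at (fst p))"
    by (auto simp: differentiable_def)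
  then have "((\<lambda>t. f (t, snd p)) has_real_derivative pd_x f p) (at (fst p))"
    unfolding pd_x_def by (simp add: DERIV_deriv_iff_real_differentiable)
  then have "((\<lambda>t. f (t + fst p, snd p)) has_real_derivative pd_x f p) (at 0)"
    using DERIV_shift[of "\<lambda>t. f (t, snd p)" _ 0 "fst p"] by simp
  moreover have "p + t *\<^sub>R (1, 0) = (t + fst p, snd p)" for t
    by (cases p) simp
  ultimately show ?thesis by simp
qed

lemma has_real_derivative_pd_y:
  assumes "f differentiable (at p)"
  shows "((\<lambda>t. f (p + t *\<^sub>R (0, 1))) has_real_derivative pd_y f p) (at 0)"
proof -
  obtain f' where f': "(f has_derivative f') (at p)"
    using assms by (auto simp: differentiable_def)
  have "((\<lambda>t. f (fst p, t)) has_derivative (\<lambda>t. f' (0, t))) (at (snd p))"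
    using has_derivative_compose[of "\<lambda>t. (fst p, t)" "\<lambda>t. (0, t)" "snd p" UNIV f f'] f'
    by (simp add: has_derivative_Pair)
  then have "(\<lambda>t. f (fst p, t)) differentiable (at (snd p))"
    by (auto simp: differentiable_def)
  then have "((\<lambda>t. f (fst p, t)) has_real_derivative pd_y f p) (at (snd p))"
    unfolding pd_y_def by (simp add: DERIV_deriv_iff_real_differentiable)
  then have "((\<lambda>t. f (fst p, t + snd p)) has_real_derivative pd_y f p) (at 0)"
    using DERIV_shift[of "\<lambda>t. f (fst p, t)" _ 0 "snd p"] by simp
  moreover have "p + t *\<^sub>R (0, 1) = (fst p, t + snd p)" for t
    by (cases p) simp
  ultimately show ?thesis by simp
qed

section \<open>Differentiating a polynomial approximation\<close>

text \<open>The combination is the one that annihilates the Taylor terms of order 0, 2 and 3 at \<open>x\<close>. The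
constant is $27/2$ rounded up: the remainders contribute $(18 \cdot 1 + 9 \cdot 2^4 + 2 \cdot 3^4)/24$.\<close>

lemma four_point_difference:
  fixes D :: "nat \<Rightarrow> real \<Rightarrow> real"
  assumes h: "0 < h"
    and D: "\<And>i t. i < 4 \<Longrightarrow> x \<le> t \<Longrightarrow> t \<le> x + 3 * h \<Longrightarrow> (D i has_real_derivative D (Suc i) t) (at t)"
    and M: "\<And>t. x \<le> t \<Longrightarrow> t \<le> x + 3 * h \<Longrightarrow> \<bar>D 4 t\<bar> \<le> M"
  shows "\<bar>- 11 * D 0 x + 18 * D 0 (x + h) - 9 * D 0 (x + 2 * h) + 2 * D 0 (x + 3 * h) - 6 * h * D 1 x\<bar>
           \<le> 14 * M * h ^ 4"
proof -
  have T: "\<bar>D 0 (x + j * h) - (D 0 x + D 1 x * (j * h) + D 2 x * (j * h)^2 / 2 + D 3 x * (j * h)^3 / 6)\<bar>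
             \<le> M * (j * h)^4 / 24"
    if j: "j \<in> {1, 2, 3}" for j :: real
  proof -
    have jh: "0 < j * h" "j * h \<le> 3 * h" using j h by auto
    have "\<exists>t>x. t < x + j * h \<and>
        D 0 (x + j * h) = (\<Sum>m<4. D m x / fact m * (x + j * h - x) ^ m) + D 4 t / fact 4 * (x + j * h - x) ^ 4"
      by (rule Taylor_up[where a = x]) (use jh D in auto)
    then obtain t where t: "x < t" "t < x + j * h"
      "D 0 (x + j * h) = (\<Sum>m<4. D m x / fact m * (j * h) ^ m) + D 4 t / fact 4 * (j * h) ^ 4"
      by auto
    have "D 0 (x + j * h) - (D 0 x + D 1 x * (j * h) + D 2 x * (j * h)^2 / 2 + D 3 x * (j * h)^3 / 6)
        = D 4 t * (j * h) ^ 4 / 24"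
      unfolding t(3) by (simp add: eval_nat_numeral fact_numeral)
    moreover have "\<bar>D 4 t * (j * h) ^ 4 / 24\<bar> \<le> M * (j * h) ^ 4 / 24"
      using M[of t] t jh by (simp add: abs_mult mult_right_mono)
    ultimately show ?thesis by (simp only:)
  qed
  define u v w z where "u = h * D 1 x" and "v = h^2 * D 2 x" and "w = h^3 * D 3 x" and "z = M * h ^ 4"
  have "\<bar>D 0 (x + h) - (D 0 x + u + v / 2 + w / 6)\<bar> \<le> z / 24"
    using T[of 1] by (simp add: u_def v_def w_def z_def mult.commute)
  moreover have "\<bar>D 0 (x + 2 * h) - (D 0 x + 2 * u + 2 * v + 4 * w / 3)\<bar> \<le> 2 * z / 3"
    using T[of 2] by (simp add: u_def v_def w_def z_def power_mult_distrib algebra_simps)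
  moreover have "\<bar>D 0 (x + 3 * h) - (D 0 x + 3 * u + 9 * v / 2 + 9 * w / 2)\<bar> \<le> 27 * z / 8"
    using T[of 3] by (simp add: u_def v_def w_def z_def power_mult_distrib algebra_simps)
  moreover have "0 \<le> z" using M[of x] h by (simp add: z_def)
  ultimately have "\<bar>- 11 * D 0 x + 18 * D 0 (x + h) - 9 * D 0 (x + 2 * h) + 2 * D 0 (x + 3 * h) - 6 * u\<bar> \<le> 14 * z"
    by linarith
  then show ?thesis by (simp add: u_def z_def)
qed

text \<open>The four-point difference at a point \<open>p\<close> of norm $r$, with a step proportional to $r$, sees \<open>f - Q\<close>
only at points of norm at most $7r$, where it is $O(r^{m+1})$; dividing by the step loses one power of
$r$. The truncation error of the difference for \<open>f\<close> is $O(r^4)$ before the division, whence \<open>m \<le> 3\<close>.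
The pair \<open>e\<close>, \<open>d\<close> abstracts a coordinate direction together with the corresponding partial derivative.\<close>

lemma bigo_directional_derivative:
  fixes f Q Q' :: "real \<times> real \<Rightarrow> real" and e :: "real \<times> real"
    and d :: "(real \<times> real \<Rightarrow> real) \<Rightarrow> real \<times> real \<Rightarrow> real"
  assumes U: "open U" "0 \<in> U"
    and d: "\<And>g q. C_inf_on U g \<Longrightarrow> q \<in> U \<Longrightarrow> ((\<lambda>t. g (q + t *\<^sub>R e)) has_real_derivative d g q) (at 0)"
    and d_smooth: "\<And>g. C_inf_on U g \<Longrightarrow> C_inf_on U (d g)"
    and e: "norm e = 1"
    and f: "C_inf_on U f"
    and m: "m \<le> 3"
    and bound: "(\<lambda>p. f p - Q p) \<in> O[at 0](\<lambda>p. norm p ^ Suc m)"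
    and exact: "\<And>p h. - 11 * Q p + 18 * Q (p + h *\<^sub>R e) - 9 * Q (p + (2 * h) *\<^sub>R e) + 2 * Q (p + (3 * h) *\<^sub>R e)
                  = 6 * h * Q' p"
  shows "(\<lambda>p. d f p - Q' p) \<in> O[at 0](\<lambda>p. norm p ^ m)"
proof -
  have smooth: "C_inf_on U ((d ^^ i) f)" for i
    by (induction i) (auto intro: f d_smooth)
  obtain K where K: "K > 0" and "\<forall>\<^sub>F p in at 0. norm (f p - Q p) \<le> K * norm (norm p ^ Suc m)"
    using bound by (auto elim: landau_o.bigE)
  then obtain r1 where r1: "r1 > 0"
    "\<And>p. p \<noteq> 0 \<Longrightarrow> norm p < r1 \<Longrightarrow> \<bar>f p - Q p\<bar> \<le> K * norm p ^ Suc m"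
    by (auto simp: eventually_at dist_norm)
  define M where "M = \<bar>(d ^^ 4) f 0\<bar> + 1"
  have "isCont ((d ^^ 4) f) 0" using C_inf_on_isCont[OF smooth U] .
  then have "((\<lambda>p. \<bar>(d ^^ 4) f p\<bar>) \<longlongrightarrow> \<bar>(d ^^ 4) f 0\<bar>) (nhds 0)"
    by (intro tendsto_intros) (simp add: isCont_def tendsto_at_iff_tendsto_nhds)
  then have "\<forall>\<^sub>F p in nhds 0. \<bar>(d ^^ 4) f p\<bar> < M"
    by (rule order_tendstoD) (simp add: M_def)
  moreover have "\<forall>\<^sub>F p in nhds 0. p \<in> U" using U by (rule eventually_nhds_in_open)
  ultimately have "\<forall>\<^sub>F p in nhds 0. \<bar>(d ^^ 4) f p\<bar> < M \<and> p \<in> U" by (rule eventually_conj)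
  then obtain r2 where r2: "r2 > 0" "\<And>p. norm p < r2 \<Longrightarrow> \<bar>(d ^^ 4) f p\<bar> \<le> M \<and> p \<in> U"
    by (auto simp: eventually_nhds_metric dist_norm less_imp_le)
  define r where "r = min 1 (min r1 r2) / 7"
  define L where "L = (40 * K * 7 ^ Suc m + 224 * M) / 12"
  have "\<bar>d f p - Q' p\<bar> \<le> L * norm p ^ m" if p: "p \<noteq> 0" "norm p < r" for p
  proof -
    define n where "n = norm p"
    \<comment> \<open>A step longer than the norm of \<open>p\<close> makes sure that no sample point is the origin, where
      the asymptotic bound says nothing.\<close>
    define h where "h = 2 * n"
    have n: "0 < n" "n \<le> 1" "7 * n < r1" "7 * n < r2" using p by (auto simp: n_def r_def)
    have near: "norm (p + t *\<^sub>R e) \<le> 7 * n" if "0 \<le> t" "t \<le> 3 * h" for t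
      using norm_triangle_ineq[of p "t *\<^sub>R e"] that e by (simp add: n_def h_def)
    have away: "p + t *\<^sub>R e \<noteq> 0" if "h \<le> t" for t
    proof
      assume "p + t *\<^sub>R e = 0"
      then have "norm p = norm (t *\<^sub>R e)" using norm_minus_cancel[of "t *\<^sub>R e"] by (simp only: add_eq_0_iff2)
      then show False using that e n by (simp add: n_def h_def)
    qed
    define D where "D i t = (d ^^ i) f (p + t *\<^sub>R e)" for i t
    have der: "(D i has_real_derivative D (Suc i) t) (at t)" if "0 \<le> t" "t \<le> 3 * h" for i t
    proof -
      have "p + t *\<^sub>R e \<in> U" using near[OF that] n r2(2)[of "p + t *\<^sub>R e"] by simp
      from d[OF smooth[of i] this]
      have "((\<lambda>s. D i (s + t)) has_real_derivative D (Suc i) t) (at 0)"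
        by (simp add: D_def algebra_simps)
      then show ?thesis using DERIV_shift[of "D i" _ 0 t] by simp
    qed
    have "\<bar>D 4 t\<bar> \<le> M" if "0 \<le> t" "t \<le> 3 * h" for t
      unfolding D_def using near[OF that] n r2(2)[of "p + t *\<^sub>R e"] by simp
    then have diff: "\<bar>- 11 * D 0 0 + 18 * D 0 h - 9 * D 0 (2 * h) + 2 * D 0 (3 * h) - 6 * h * D 1 0\<bar>
        \<le> 14 * M * h ^ 4"
      using four_point_difference[of h 0 D M] der n by (simp add: h_def)
    have err: "\<bar>D 0 t - Q (p + t *\<^sub>R e)\<bar> \<le> K * (7 * n) ^ Suc m" if "t \<in> {0, h, 2 * h, 3 * h}" for t
    proof -
      have t: "0 \<le> t" "t \<le> 3 * h" using that n by (auto simp: h_def)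
      have "p + t *\<^sub>R e \<noteq> 0" using that p(1) away[of t] n by (auto simp: h_def)
      then have "\<bar>D 0 t - Q (p + t *\<^sub>R e)\<bar> \<le> K * norm (p + t *\<^sub>R e) ^ Suc m"
        using r1(2)[of "p + t *\<^sub>R e"] near[OF t] n by (simp add: D_def)
      also have "\<dots> \<le> K * (7 * n) ^ Suc m"
        using K near[OF t] by (intro mult_left_mono power_mono) auto
      finally show ?thesis .
    qed
    have "\<bar>6 * h * (D 1 0 - Q' p)\<bar> \<le> 40 * (K * (7 * n) ^ Suc m) + 14 * M * h ^ 4"
      using err[of 0] err[of h] err[of "2 * h"] err[of "3 * h"] diff exact[of p h]
      unfolding abs_le_iff by (simp add: right_diff_distrib)
    moreover have "n ^ 4 \<le> n ^ Suc m"
      using n m by (intro power_decreasing) auto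
    then have "M * n ^ 4 \<le> M * n ^ Suc m"
      by (intro mult_left_mono) (auto simp: M_def)
    then have "14 * M * h ^ 4 \<le> 224 * M * n ^ Suc m"
      by (simp add: h_def power_mult_distrib)
    moreover have "40 * (K * (7 * n) ^ Suc m) + 224 * M * n ^ Suc m = 12 * n * (L * n ^ m)"
      by (simp add: L_def power_mult_distrib algebra_simps)
    ultimately have "\<bar>6 * h * (D 1 0 - Q' p)\<bar> \<le> 12 * n * (L * n ^ m)"
      by linarith
    then have "12 * n * \<bar>D 1 0 - Q' p\<bar> \<le> 12 * n * (L * n ^ m)"
      using n by (simp add: h_def abs_mult)
    then show ?thesis using n by (simp add: D_def n_def)
  qed
  moreover have "r > 0" using r1 r2 by (simp add: r_def)
  ultimately have "\<forall>\<^sub>F p in at 0. norm (d f p - Q' p) \<le> L * norm (norm p ^ m)"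
    by (auto simp: eventually_at dist_norm intro!: exI[of _ r])
  then show ?thesis by (rule bigoI)
qed

lemma bigo_pd_x:
  fixes f Q Q' :: "real \<times> real \<Rightarrow> real"
  assumes "open U" "0 \<in> U" "C_inf_on U f" "m \<le> 3"
    and "(\<lambda>p. f p - Q p) \<in> O[at 0](\<lambda>p. norm p ^ Suc m)"
    and "\<And>x y h. - 11 * Q (x, y) + 18 * Q (x + h, y) - 9 * Q (x + 2 * h, y) + 2 * Q (x + 3 * h, y)
                  = 6 * h * Q' (x, y)"
  shows "(\<lambda>p. pd_x f p - Q' p) \<in> O[at 0](\<lambda>p. norm p ^ m)"
proof (rule bigo_directional_derivative[where e = "(1, 0)" and d = pd_x, OF assms(1,2) _ _ _ assms(3,4,5)])
  show "((\<lambda>t. g (q + t *\<^sub>R (1, 0))) has_real_derivative pd_x g q) (at 0)"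
    if "C_inf_on U g" "q \<in> U" for g q
    using C_inf_on_differentiable[OF that(1) assms(1) that(2)] by (rule has_real_derivative_pd_x)
  show "- 11 * Q p + 18 * Q (p + h *\<^sub>R (1, 0)) - 9 * Q (p + (2 * h) *\<^sub>R (1, 0))
      + 2 * Q (p + (3 * h) *\<^sub>R (1, 0)) = 6 * h * Q' p" for p h
    using assms(6) by (cases p) simp
qed (simp_all add: C_inf_on_pd_x)

lemma bigo_pd_y:
  fixes f Q Q' :: "real \<times> real \<Rightarrow> real"
  assumes "open U" "0 \<in> U" "C_inf_on U f" "m \<le> 3"
    and "(\<lambda>p. f p - Q p) \<in> O[at 0](\<lambda>p. norm p ^ Suc m)"
    and "\<And>x y h. - 11 * Q (x, y) + 18 * Q (x, y + h) - 9 * Q (x, y + 2 * h) + 2 * Q (x, y + 3 * h)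
                  = 6 * h * Q' (x, y)"
  shows "(\<lambda>p. pd_y f p - Q' p) \<in> O[at 0](\<lambda>p. norm p ^ m)"
proof (rule bigo_directional_derivative[where e = "(0, 1)" and d = pd_y, OF assms(1,2) _ _ _ assms(3,4,5)])
  show "((\<lambda>t. g (q + t *\<^sub>R (0, 1))) has_real_derivative pd_y g q) (at 0)"
    if "C_inf_on U g" "q \<in> U" for g q
    using C_inf_on_differentiable[OF that(1) assms(1) that(2)] by (rule has_real_derivative_pd_y)
  show "- 11 * Q p + 18 * Q (p + h *\<^sub>R (0, 1)) - 9 * Q (p + (2 * h) *\<^sub>R (0, 1))
      + 2 * Q (p + (3 * h) *\<^sub>R (0, 1)) = 6 * h * Q' p" for p h
    using assms(6) by (cases p) simp
qed (simp_all add: C_inf_on_pd_y)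

section \<open>The scale adapted to the cusps\<close>

text \<open>The gauge that is homogeneous of degree one under $(x,y) \mapsto (t^3 x, t^2 y)$, the weights under
which the cusps $x^2 \sim y^3$ are invariant.\<close>

definition cusp_scale :: "real \<times> real \<Rightarrow> real"
  where "cusp_scale p = max (root 3 \<bar>fst p\<bar>) (sqrt \<bar>snd p\<bar>)"

lemma cusp_scale_pos: "p \<noteq> 0 \<Longrightarrow> cusp_scale p > 0"
  by (cases p) (auto simp: cusp_scale_def less_max_iff_disj zero_prod_def)

lemma abs_fst_le_cusp_scale: "\<bar>fst p\<bar> \<le> cusp_scale p ^ 3"
proof -
  have "root 3 \<bar>fst p\<bar> ^ 3 \<le> cusp_scale p ^ 3"
    by (intro power_mono) (auto simp: cusp_scale_def)
  then show ?thesis by simp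
qed

lemma abs_snd_le_cusp_scale: "\<bar>snd p\<bar> \<le> cusp_scale p ^ 2"
proof -
  have "sqrt \<bar>snd p\<bar> ^ 2 \<le> cusp_scale p ^ 2"
    by (intro power_mono) (auto simp: cusp_scale_def)
  then show ?thesis by simp
qed

text \<open>This keeps the limits of the rescaled coordinates away from the origin.\<close>

lemma cusp_scale_attained: "\<bar>fst p\<bar> = cusp_scale p ^ 3 \<or> \<bar>snd p\<bar> = cusp_scale p ^ 2"
proof (cases "sqrt \<bar>snd p\<bar> \<le> root 3 \<bar>fst p\<bar>")
  case True
  then have "cusp_scale p = root 3 \<bar>fst p\<bar>" by (simp add: cusp_scale_def)
  then show ?thesis by simp
next
  case False
  then have "cusp_scale p = sqrt \<bar>snd p\<bar>" by (simp add: cusp_scale_def)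
  then show ?thesis by simp
qed

lemma cusp_scale_tendsto_0: "(cusp_scale \<longlongrightarrow> 0) (at 0)"
proof -
  have "((\<lambda>p::real \<times> real. max (root 3 \<bar>fst p\<bar>) (sqrt \<bar>snd p\<bar>))
          \<longlongrightarrow> max (root 3 \<bar>fst (0 :: real \<times> real)\<bar>) (sqrt \<bar>snd (0 :: real \<times> real)\<bar>)) (at 0)"
    by (intro tendsto_intros)
  then show ?thesis by (simp add: cusp_scale_def[abs_def])
qed

lemma norm_bigo_cusp_scale: "(\<lambda>p::real \<times> real. norm p) \<in> O[at 0](\<lambda>p. cusp_scale p ^ 2)"
proof (rule bigoI)
  have "\<forall>\<^sub>F p in at 0. cusp_scale p < 1"
    using cusp_scale_tendsto_0 by (rule order_tendstoD) simp
  then show "\<forall>\<^sub>F p in at 0. norm (norm p) \<le> 2 * norm (cusp_scale p ^ 2)"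
    using eventually_neq_at_within[of 0 0 UNIV]
  proof eventually_elim
    case (elim p)
    have "cusp_scale p ^ 3 \<le> cusp_scale p ^ 2"
      using elim cusp_scale_pos[of p] by (intro power_decreasing) auto
    moreover have "norm p \<le> \<bar>fst p\<bar> + \<bar>snd p\<bar>"
      using norm_Pair_le[of "fst p" "snd p"] by simp
    ultimately show ?case
      using abs_fst_le_cusp_scale[of p] abs_snd_le_cusp_scale[of p] by simp
  qed
qed

text \<open>Since $|x| \le s^3$ and $|y| \le s^2$, the norm is $O(s^2)$, and no better along the $y$-axis; this is
why an order $m$ in the norm counts as an order $2m$ in $s$.\<close>

lemma bigo_norm_imp_scaled_tendsto_0:
  fixes g :: "real \<times> real \<Rightarrow> real"
  assumes g: "g \<in> O[at 0](\<lambda>p. norm p ^ m)" and k: "k < 2 * m"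
  shows "((\<lambda>p. g p / cusp_scale p ^ k) \<longlongrightarrow> 0) (at 0)"
proof -
  have "g \<in> O[at 0](\<lambda>p. (cusp_scale p ^ 2) ^ m)"
    by (rule landau_o.big_trans[OF g landau_o.big_power[OF norm_bigo_cusp_scale]])
  then obtain c where c: "c > 0"
    and le: "\<forall>\<^sub>F p in at 0. norm (g p) \<le> c * norm ((cusp_scale p ^ 2) ^ m)"
    by (auto elim: landau_o.bigE)
  show ?thesis
  proof (rule Lim_null_comparison)
    show "\<forall>\<^sub>F p in at 0. norm (g p / cusp_scale p ^ k) \<le> c * cusp_scale p ^ (2 * m - k)"
      using le eventually_neq_at_within[of 0 0 UNIV]
    proof eventually_elim
      case (elim p)
      have "2 * m = (2 * m - k) + k" using k by simp
      then have "(cusp_scale p ^ 2) ^ m = cusp_scale p ^ (2 * m - k) * cusp_scale p ^ k"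
        by (metis power_add power_mult)
      then show ?case
        using elim cusp_scale_pos[of p] by (simp add: field_simps)
    qed
    have "((\<lambda>p. c * cusp_scale p ^ (2 * m - k)) \<longlongrightarrow> c * 0 ^ (2 * m - k)) (at 0)"
      by (intro tendsto_intros cusp_scale_tendsto_0)
    then show "((\<lambda>p. c * cusp_scale p ^ (2 * m - k)) \<longlongrightarrow> 0) (at 0)"
      using k by (simp add: power_0_left)
  qed
qed

section \<open>Leading forms of the vertex function and of the curvature\<close>

text \<open>Here \<open>A\<close>, \<open>C\<close> and \<open>G\<close> are the limits of $f_x/s^3$, $f_y/s^4$ and $f_{yy}/s^2$; the two equations are the
leading form of the vertex function and that of the numerator of the curvature. The second equation
forces $A^2 = -3b\eta^3$ unless $\eta = 0$, and then the first one becomes $54 b^3 A \eta^6 = 0$.\<close>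

lemma leading_forms_no_common_zero:
  fixes b \<xi> \<eta> A C G :: real
  assumes b: "b \<noteq> 0" and A: "A = 2 * \<xi>" and C: "C = 3 * b * \<eta>^2" and G: "G = 6 * b * \<eta>"
    and V: "6 * b * A^5 + 3 * A * C * (4 * C^2 + 2 * A^2 * G) = 0"
    and N: "2 * C^2 + G * A^2 = 0"
  shows "\<xi> = 0 \<and> \<eta> = 0"
proof (cases "\<eta> = 0")
  case True
  then show ?thesis using V b A C by simp
next
  case False
  have "6 * b * \<eta> * (A^2 + 3 * b * \<eta>^3) = 0"
    using N unfolding C G by (simp add: power2_eq_square power3_eq_cube algebra_simps)
  then have A2: "A^2 = - 3 * b * \<eta>^3" using b False by simp
  then have "A \<noteq> 0" using b False by auto
  have "6 * b * A * ((A^2)^2 + 18 * b * \<eta>^3 * A^2 + 54 * b^2 * \<eta>^6) = 0"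
    using V unfolding C G by (simp add: eval_nat_numeral algebra_simps)
  then have "(A^2)^2 + 18 * b * \<eta>^3 * A^2 + 54 * b^2 * \<eta>^6 = 0" using b \<open>A \<noteq> 0\<close> by simp
  then have "9 * b^2 * \<eta>^6 = 0"
    unfolding A2 by (simp add: eval_nat_numeral algebra_simps)
  then show ?thesis using b False by simp
qed

text \<open>Differentiating the cubic jet leaves each derivative with an error that is negligible after division
by its power of $s$. The remaining jet terms acquire positive powers of $s$ once
$x = \xi s^3$ and $y = \eta s^2$ are substituted, except for those that give the stated limits.\<close>

lemma rescaled_partials_tendsto:
  fixes f :: "real \<times> real \<Rightarrow> real" and p :: "nat \<Rightarrow> real \<times> real"
  assumes U: "open U" "0 \<in> U" and f: "C_inf_on U f"
    and jet: "(\<lambda>(x, y). f (x, y) - (x^2 + b0 * x^3 + b1 * x^2 * y + b2 * x * y^2 + b3 * y^3))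
                \<in> O[at 0](\<lambda>q. norm q ^ 4)"
    and p: "filterlim p (at 0) sequentially" and p0: "\<And>n. p n \<noteq> 0"
    and \<xi>: "(\<lambda>n. fst (p n) / cusp_scale (p n) ^ 3) \<longlonglongrightarrow> \<xi>"
    and \<eta>: "(\<lambda>n. snd (p n) / cusp_scale (p n) ^ 2) \<longlonglongrightarrow> \<eta>"
  shows "(\<lambda>n. pd_x f (p n) / cusp_scale (p n) ^ 3) \<longlonglongrightarrow> 2 * \<xi>"
    and "(\<lambda>n. pd_y f (p n) / cusp_scale (p n) ^ 4) \<longlonglongrightarrow> 3 * b3 * \<eta>^2"
    and "(\<lambda>n. pd_x (pd_x f) (p n)) \<longlonglongrightarrow> 2"
    and "(\<lambda>n. pd_y (pd_x f) (p n) / cusp_scale (p n)) \<longlonglongrightarrow> 0"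
    and "(\<lambda>n. pd_y (pd_y f) (p n) / cusp_scale (p n) ^ 2) \<longlonglongrightarrow> 6 * b3 * \<eta>"
    and "(\<lambda>n. pd_y (pd_y (pd_y f)) (p n)) \<longlonglongrightarrow> 6 * b3"
proof -
  let ?x = "fst :: real \<times> real \<Rightarrow> real" and ?y = "snd :: real \<times> real \<Rightarrow> real"
  note smooth = f C_inf_on_pd_x C_inf_on_pd_y
  have O_f: "(\<lambda>q. f q - (?x q^2 + b0 * ?x q^3 + b1 * ?x q^2 * ?y q + b2 * ?x q * ?y q^2 + b3 * ?y q^3))
      \<in> O[at 0](\<lambda>q. norm q ^ Suc 3)"
    using jet by (simp add: case_prod_beta')
  have O_x: "(\<lambda>q. pd_x f q - (2 * ?x q + 3 * b0 * ?x q^2 + 2 * b1 * ?x q * ?y q + b2 * ?y q^2))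
      \<in> O[at 0](\<lambda>q. norm q ^ Suc 2)"
    using bigo_pd_x[OF U f _ O_f]
    by (simp add: eval_nat_numeral algebra_simps)
  have O_y: "(\<lambda>q. pd_y f q - (b1 * ?x q^2 + 2 * b2 * ?x q * ?y q + 3 * b3 * ?y q^2))
      \<in> O[at 0](\<lambda>q. norm q ^ Suc 2)"
    using bigo_pd_y[OF U f _ O_f]
    by (simp add: eval_nat_numeral algebra_simps)
  have O_xx: "(\<lambda>q. pd_x (pd_x f) q - (2 + 6 * b0 * ?x q + 2 * b1 * ?y q)) \<in> O[at 0](\<lambda>q. norm q ^ 2)"
    by (rule bigo_pd_x[OF U _ _ O_x]) (simp_all add: smooth eval_nat_numeral algebra_simps)
  have O_xy: "(\<lambda>q. pd_y (pd_x f) q - (2 * b1 * ?x q + 2 * b2 * ?y q)) \<in> O[at 0](\<lambda>q. norm q ^ 2)"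
    by (rule bigo_pd_y[OF U _ _ O_x]) (simp_all add: smooth eval_nat_numeral algebra_simps)
  have O_yy: "(\<lambda>q. pd_y (pd_y f) q - (2 * b2 * ?x q + 6 * b3 * ?y q)) \<in> O[at 0](\<lambda>q. norm q ^ Suc 1)"
    using bigo_pd_y[OF U _ _ O_y]
    by (simp add: smooth eval_nat_numeral algebra_simps)
  have O_yyy: "(\<lambda>q. pd_y (pd_y (pd_y f)) q - 6 * b3) \<in> O[at 0](\<lambda>q. norm q ^ 1)"
    by (rule bigo_pd_y[OF U _ _ O_yy]) (simp_all add: smooth algebra_simps)

  define s where "s n = cusp_scale (p n)" for n
  define u where "u n = fst (p n) / s n ^ 3" for n
  define v where "v n = snd (p n) / s n ^ 2" for n
  have s_pos: "s n \<noteq> 0" for n using cusp_scale_pos[OF p0[of n]] by (simp add: s_def)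
  have s: "s \<longlonglongrightarrow> 0"
    unfolding s_def[abs_def] using cusp_scale_tendsto_0 p by (rule filterlim_compose)
  have u: "u \<longlonglongrightarrow> \<xi>" and v: "v \<longlonglongrightarrow> \<eta>"
    using \<xi> \<eta> by (simp_all add: u_def[abs_def] v_def[abs_def] s_def)
  have xy: "fst (p n) = u n * s n ^ 3" "snd (p n) = v n * s n ^ 2" for n
    using s_pos[of n] by (simp_all add: u_def v_def)
  \<comment> \<open>\<open>w\<close> is the jet polynomial \<open>Q\<close> in rescaled coordinates, divided by \<open>s ^ k\<close>; the remainder is
    negligible when its order \<open>2 * m\<close> in \<open>s\<close> exceeds \<open>k\<close>.\<close>
  have transfer: "(\<lambda>n. g (p n) / s n ^ k) \<longlonglongrightarrow> l"
    if rem: "(\<lambda>q. g q - Q q) \<in> O[at 0](\<lambda>q. norm q ^ m)" and k: "k < 2 * m"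
      and Q: "\<And>n. Q (p n) = s n ^ k * w n" and w: "w \<longlonglongrightarrow> l" for g Q k m w l
  proof -
    have "(\<lambda>n. (g (p n) - Q (p n)) / s n ^ k) \<longlonglongrightarrow> 0"
      unfolding s_def using bigo_norm_imp_scaled_tendsto_0[OF rem k] p by (rule filterlim_compose)
    then have "(\<lambda>n. (g (p n) - Q (p n)) / s n ^ k + w n) \<longlonglongrightarrow> 0 + l"
      using w by (rule tendsto_add)
    moreover have "(g (p n) - Q (p n)) / s n ^ k + w n = g (p n) / s n ^ k" for n
      using s_pos[of n] by (simp add: Q field_simps)
    ultimately show ?thesis by simp
  qed
  note lims = tendsto_eq_intros u v s

  have "(\<lambda>n. pd_x f (p n) / s n ^ 3) \<longlonglongrightarrow> 2 * \<xi>"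
    by (rule transfer[OF O_x, where w = "\<lambda>n. 2 * u n + 3 * b0 * u n^2 * s n^3 + 2 * b1 * u n * v n * s n^2 + b2 * v n^2 * s n"])
       (simp add: xy eval_nat_numeral algebra_simps | (rule lims)+)+
  then show "(\<lambda>n. pd_x f (p n) / cusp_scale (p n) ^ 3) \<longlonglongrightarrow> 2 * \<xi>" by (simp add: s_def)
  have "(\<lambda>n. pd_y f (p n) / s n ^ 4) \<longlonglongrightarrow> 3 * b3 * \<eta>^2"
    by (rule transfer[OF O_y, where w = "\<lambda>n. b1 * u n^2 * s n^2 + 2 * b2 * u n * v n * s n + 3 * b3 * v n^2"])
       (simp add: xy eval_nat_numeral algebra_simps | (rule lims)+)+
  then show "(\<lambda>n. pd_y f (p n) / cusp_scale (p n) ^ 4) \<longlonglongrightarrow> 3 * b3 * \<eta>^2" by (simp add: s_def)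
  have "(\<lambda>n. pd_x (pd_x f) (p n) / s n ^ 0) \<longlonglongrightarrow> 2"
    by (rule transfer[OF O_xx, where w = "\<lambda>n. 2 + 6 * b0 * u n * s n^3 + 2 * b1 * v n * s n^2"])
       (simp add: xy eval_nat_numeral algebra_simps | (rule lims)+)+
  then show "(\<lambda>n. pd_x (pd_x f) (p n)) \<longlonglongrightarrow> 2" by simp
  have "(\<lambda>n. pd_y (pd_x f) (p n) / s n ^ 1) \<longlonglongrightarrow> 0"
    by (rule transfer[OF O_xy, where w = "\<lambda>n. 2 * b1 * u n * s n^2 + 2 * b2 * v n * s n"])
       (simp add: xy eval_nat_numeral algebra_simps | (rule lims)+)+
  then show "(\<lambda>n. pd_y (pd_x f) (p n) / cusp_scale (p n)) \<longlonglongrightarrow> 0" by (simp add: s_def)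
  have "(\<lambda>n. pd_y (pd_y f) (p n) / s n ^ 2) \<longlonglongrightarrow> 6 * b3 * \<eta>"
    by (rule transfer[OF O_yy, where w = "\<lambda>n. 2 * b2 * u n * s n + 6 * b3 * v n"])
       (simp add: xy eval_nat_numeral algebra_simps | (rule lims)+)+
  then show "(\<lambda>n. pd_y (pd_y f) (p n) / cusp_scale (p n) ^ 2) \<longlonglongrightarrow> 6 * b3 * \<eta>" by (simp add: s_def)
  have "(\<lambda>n. pd_y (pd_y (pd_y f)) (p n) / s n ^ 0) \<longlonglongrightarrow> 6 * b3"
    by (rule transfer[OF O_yyy, where w = "\<lambda>n. 6 * b3"]) simp_all
  then show "(\<lambda>n. pd_y (pd_y (pd_y f)) (p n)) \<longlonglongrightarrow> 6 * b3" by simp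
qed

lemma abs_level_curvature_nonneg: "0 \<le> abs_level_curvature f p"
  by (simp add: abs_level_curvature_def Let_def)

text \<open>In this division-free form the formula for the curvature also holds at critical points of \<open>f\<close>, because
both sides vanish there.\<close>

lemma abs_level_curvature_squared:
  "(abs_level_curvature f p)^2 * ((pd_x f p)^2 + (pd_y f p)^2)^3
     = (pd_x (pd_x f) p * (pd_y f p)^2 - 2 * pd_y (pd_x f) p * pd_x f p * pd_y f p
        + pd_y (pd_y f) p * (pd_x f p)^2)^2"
proof (cases "(pd_x f p)^2 + (pd_y f p)^2 = 0")
  case True
  then have "pd_x f p = 0" "pd_y f p = 0" by (simp_all add: sum_power2_eq_zero_iff)
  then show ?thesis by simp
next
  case False
  then show ?thesis by (simp add: abs_level_curvature_def Let_def)
qed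

text \<open>Each monomial of the vertex function has weight at least 15 when $f_x$, $f_y$, $f_{xy}$ and $f_{yy}$
have the weights 3, 4, 1 and 2; the surviving powers of $s$ record the excess.\<close>

lemma vertex_fun_rescaled:
  fixes s :: real
  assumes "pd_x f p = s^3 * A" "pd_y f p = s^4 * C"
    and "pd_x (pd_x f) p = E" "pd_y (pd_x f) p = s * F" "pd_y (pd_y f) p = s^2 * G"
    and "pd_x (pd_x (pd_x f)) p = X" "pd_y (pd_x (pd_x f)) p = Y"
    and "pd_y (pd_y (pd_x f)) p = Z" "pd_y (pd_y (pd_y f)) p = W"
  shows "vertex_fun f p = s^15 *
    ((A^2 + s^2 * C^2) * (- (s^3 * C^3 * X) + 3 * s^2 * A * C^2 * Y - 3 * s * A^2 * C * Z + A^3 * W)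
     + 3 * A * C * (C^2 * E^2 + (A^2 - s^2 * C^2) * E * G - s^2 * A^2 * G^2)
     + 6 * A * C * F^2 * (A^2 - s^2 * C^2)
     + 3 * F * (s^2 * E * C^4 - 3 * A^2 * C^2 * (E - s^2 * G) - G * A^4))"
  unfolding vertex_fun_def Let_def assms by algebra

lemma level_curvature_rescaled:
  fixes s :: real
  assumes "s \<noteq> 0" and "pd_x f p = s^3 * A" "pd_y f p = s^4 * C"
    and "pd_x (pd_x f) p = E" "pd_y (pd_x f) p = s * F" "pd_y (pd_y f) p = s^2 * G"
  shows "(s * abs_level_curvature f p)^2 * (A^2 + s^2 * C^2)^3
           = (E * C^2 - 2 * F * A * C + G * A^2)^2"
proof -
  have "s^16 * ((s * abs_level_curvature f p)^2 * (A^2 + s^2 * C^2)^3)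
      = s^16 * (E * C^2 - 2 * F * A * C + G * A^2)^2"
    using abs_level_curvature_squared[of f p] unfolding assms(2-) by algebra
  then show ?thesis using assms(1) by simp
qed

section \<open>The curvature along the vertex set\<close>

text \<open>Bounded curvature makes the product of $s$ and the curvature tend to zero, so the leading form of the
numerator vanishes at $(\xi,\eta)$; being on the vertex set makes the leading form of the vertex
function vanish there too. The two forms have only the origin as a common zero.\<close>

lemma no_bounded_curvature_sequence:
  fixes f :: "real \<times> real \<Rightarrow> real" and p :: "nat \<Rightarrow> real \<times> real"
  assumes U: "open U" "0 \<in> U" and f: "C_inf_on U f"
    and jet: "(\<lambda>(x, y). f (x, y) - (x^2 + b0 * x^3 + b1 * x^2 * y + b2 * x * y^2 + b3 * y^3))
                \<in> O[at 0](\<lambda>q. norm q ^ 4)"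
    and b3: "b3 \<noteq> 0"
    and p: "filterlim p (at 0) sequentially" and p0: "\<And>n. p n \<noteq> 0"
    and vertex: "\<And>n. p n \<in> vertex_set f" and bounded: "\<And>n. abs_level_curvature f (p n) \<le> K"
    and \<xi>: "(\<lambda>n. fst (p n) / cusp_scale (p n) ^ 3) \<longlonglongrightarrow> \<xi>"
    and \<eta>: "(\<lambda>n. snd (p n) / cusp_scale (p n) ^ 2) \<longlonglongrightarrow> \<eta>"
  shows "\<xi> = 0 \<and> \<eta> = 0"
proof -
  define s where "s n = cusp_scale (p n)" for n
  have s_pos: "s n > 0" for n using cusp_scale_pos[OF p0[of n]] by (simp add: s_def)
  have s: "s \<longlonglongrightarrow> 0"
    unfolding s_def[abs_def] using cusp_scale_tendsto_0 p by (rule filterlim_compose)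
  define A where "A n = pd_x f (p n) / s n ^ 3" for n
  define C where "C n = pd_y f (p n) / s n ^ 4" for n
  define E where "E n = pd_x (pd_x f) (p n)" for n
  define F where "F n = pd_y (pd_x f) (p n) / s n" for n
  define G where "G n = pd_y (pd_y f) (p n) / s n ^ 2" for n
  define X where "X n = pd_x (pd_x (pd_x f)) (p n)" for n
  define Y where "Y n = pd_y (pd_x (pd_x f)) (p n)" for n
  define Z where "Z n = pd_y (pd_y (pd_x f)) (p n)" for n
  define W where "W n = pd_y (pd_y (pd_y f)) (p n)" for n
  note defs = A_def C_def E_def F_def G_def X_def Y_def Z_def W_def
  have lims: "A \<longlonglongrightarrow> 2 * \<xi>" "C \<longlonglongrightarrow> 3 * b3 * \<eta>^2" "E \<longlonglongrightarrow> 2" "F \<longlonglongrightarrow> 0" "G \<longlonglongrightarrow> 6 * b3 * \<eta>"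
      "W \<longlonglongrightarrow> 6 * b3"
    using rescaled_partials_tendsto[OF U f jet p p0 \<xi> \<eta>] by (simp_all add: defs[abs_def] s_def)
  have cont: "(\<lambda>n. g (p n)) \<longlonglongrightarrow> g 0" if "C_inf_on U g" for g
    using C_inf_on_isCont[OF that U] p unfolding isCont_def by (rule filterlim_compose)
  have lims3: "X \<longlonglongrightarrow> pd_x (pd_x (pd_x f)) 0" "Y \<longlonglongrightarrow> pd_y (pd_x (pd_x f)) 0"
      "Z \<longlonglongrightarrow> pd_y (pd_y (pd_x f)) 0"
    unfolding X_def[abs_def] Y_def[abs_def] Z_def[abs_def]
    by (intro cont C_inf_on_pd_x C_inf_on_pd_y f)+
  have nonzero: "s n \<noteq> 0" for n using s_pos[of n] by simp

  define V where "V n =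
    (A n^2 + s n^2 * C n^2) * (- (s n^3 * C n^3 * X n) + 3 * s n^2 * A n * C n^2 * Y n - 3 * s n * A n^2 * C n * Z n + A n^3 * W n)
     + 3 * A n * C n * (C n^2 * E n^2 + (A n^2 - s n^2 * C n^2) * E n * G n - s n^2 * A n^2 * G n^2)
     + 6 * A n * C n * F n^2 * (A n^2 - s n^2 * C n^2)
     + 3 * F n * (s n^2 * E n * C n^4 - 3 * A n^2 * C n^2 * (E n - s n^2 * G n) - G n * A n^4)" for n
  have "vertex_fun f (p n) = s n ^ 15 * V n" for n
    unfolding V_def using nonzero[of n] by (intro vertex_fun_rescaled) (simp_all add: defs)
  then have V0: "V = (\<lambda>n. 0)" using vertex nonzero by (auto simp: vertex_set_def)
  define a c g where "a = 2 * \<xi>" and "c = 3 * b3 * \<eta>^2" and "g = 6 * b3 * \<eta>"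
  note lims' = lims[folded a_def c_def g_def] lims3 s
  have "V \<longlonglongrightarrow> (a^2 + 0^2 * c^2) * (- (0^3 * c^3 * pd_x (pd_x (pd_x f)) 0)
        + 3 * 0^2 * a * c^2 * pd_y (pd_x (pd_x f)) 0 - 3 * 0 * a^2 * c * pd_y (pd_y (pd_x f)) 0 + a^3 * (6 * b3))
     + 3 * a * c * (c^2 * 2^2 + (a^2 - 0^2 * c^2) * 2 * g - 0^2 * a^2 * g^2)
     + 6 * a * c * 0^2 * (a^2 - 0^2 * c^2)
     + 3 * 0 * (0^2 * 2 * c^4 - 3 * a^2 * c^2 * (2 - 0^2 * g) - g * a^4)"
    unfolding V_def[abs_def] by (intro tendsto_intros lims')
  then have V_lim: "6 * b3 * a^5 + 3 * a * c * (4 * c^2 + 2 * a^2 * g) = 0"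
    unfolding V0 by (simp add: LIMSEQ_const_iff eval_nat_numeral algebra_simps)

  have "(\<lambda>n. s n * abs_level_curvature f (p n)) \<longlonglongrightarrow> 0"
  proof (rule Lim_null_comparison)
    show "\<forall>\<^sub>F n in sequentially. norm (s n * abs_level_curvature f (p n)) \<le> s n * K"
      using s_pos bounded abs_level_curvature_nonneg
      by (simp add: abs_mult abs_of_pos mult_left_mono less_imp_le)
    show "(\<lambda>n. s n * K) \<longlonglongrightarrow> 0" using tendsto_mult_left_zero[OF s] .
  qed
  then have "(\<lambda>n. (s n * abs_level_curvature f (p n))^2 * (A n^2 + s n^2 * C n^2)^3)
      \<longlonglongrightarrow> 0^2 * (a^2 + 0^2 * c^2)^3"
    by (intro tendsto_intros lims')
  moreover have "(s n * abs_level_curvature f (p n))^2 * (A n^2 + s n^2 * C n^2)^3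
      = (E n * C n^2 - 2 * F n * A n * C n + G n * A n^2)^2" for n
    using nonzero[of n] by (intro level_curvature_rescaled) (simp_all add: defs)
  ultimately have "(\<lambda>n. (E n * C n^2 - 2 * F n * A n * C n + G n * A n^2)^2) \<longlonglongrightarrow> 0"
    by simp
  moreover have "(\<lambda>n. (E n * C n^2 - 2 * F n * A n * C n + G n * A n^2)^2)
      \<longlonglongrightarrow> (2 * c^2 - 2 * 0 * a * c + g * a^2)^2"
    by (intro tendsto_intros lims')
  ultimately have "0 = (2 * c^2 - 2 * 0 * a * c + g * a^2)^2" by (rule LIMSEQ_unique)
  then have "2 * c^2 + g * a^2 = 0" by simp
  with V_lim show ?thesis using leading_forms_no_common_zero[OF b3 a_def c_def g_def] by blast
qed

text \<open>Otherwise a sequence of vertices with bounded curvature tends to the origin. Its rescaled coordinates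
lie on the boundary of a square, so a subsequence of them converges to a point that is not the
origin, against the preceding lemma.\<close>

lemma curvature_at_top_within_vertex_set:
  fixes f :: "real \<times> real \<Rightarrow> real"
  assumes U: "open U" "0 \<in> U" and f: "C_inf_on U f"
    and jet: "(\<lambda>(x, y). f (x, y) - (x^2 + b0 * x^3 + b1 * x^2 * y + b2 * x * y^2 + b3 * y^3))
                \<in> O[at 0](\<lambda>q. norm q ^ 4)"
    and b3: "b3 \<noteq> 0"
  shows "filterlim (abs_level_curvature f) at_top (at 0 within vertex_set f)"
proof (rule ccontr)
  assume "\<not> ?thesis"
  then obtain K where K: "\<not> (\<forall>\<^sub>F q in at 0 within vertex_set f. K \<le> abs_level_curvature f q)"
    by (auto simp: filterlim_at_top)
  have "\<exists>q. q \<in> vertex_set f \<and> q \<noteq> 0 \<and> norm q < inverse (real (Suc n)) \<and> abs_level_curvature f q \<le> K" for n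
  proof -
    have "0 < inverse (real (Suc n))" by simp
    with K have "\<exists>q\<in>vertex_set f. q \<noteq> 0 \<and> dist q 0 < inverse (real (Suc n)) \<and> abs_level_curvature f q < K"
      unfolding eventually_at not_le[symmetric] by blast
    then show ?thesis by (force simp: dist_norm)
  qed
  then obtain p where p: "\<And>n. p n \<in> vertex_set f" "\<And>n. p n \<noteq> 0"
      "\<And>n. norm (p n) < inverse (real (Suc n))" "\<And>n. abs_level_curvature f (p n) \<le> K"
    by metis
  have "p \<longlonglongrightarrow> 0"
    by (rule Lim_null_comparison[OF _ LIMSEQ_inverse_real_of_nat])
       (use p(3) in \<open>auto intro!: always_eventually less_imp_le\<close>)
  then have p_lim: "filterlim p (at 0) sequentially"
    using p(2) by (simp add: filterlim_at)

  define z where "z n = (fst (p n) / cusp_scale (p n) ^ 3, snd (p n) / cusp_scale (p n) ^ 2)" for n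
  have "z n \<in> {-1..1} \<times> {-1..1}" for n
    using abs_fst_le_cusp_scale[of "p n"] abs_snd_le_cusp_scale[of "p n"] cusp_scale_pos[OF p(2)[of n]]
    by (auto simp: z_def abs_le_iff field_simps)
  moreover have "compact ({-1..1::real} \<times> {-1..1::real})" by (intro compact_Times compact_Icc)
  ultimately obtain l r where r: "strict_mono r" and l: "(z \<circ> r) \<longlonglongrightarrow> l"
    using seq_compactE[of "{-1..1} \<times> {-1..1}" z] unfolding compact_eq_seq_compact_metric by metis
  have l1: "(\<lambda>n. fst (z (r n))) \<longlonglongrightarrow> fst l" and l2: "(\<lambda>n. snd (z (r n))) \<longlonglongrightarrow> snd l"
    using tendsto_fst[OF l] tendsto_snd[OF l] by (simp_all add: o_def)
  have "max \<bar>fst (z n)\<bar> \<bar>snd (z n)\<bar> = 1" for n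
  proof -
    have "\<bar>fst (z n)\<bar> \<le> 1" "\<bar>snd (z n)\<bar> \<le> 1"
      using abs_fst_le_cusp_scale[of "p n"] abs_snd_le_cusp_scale[of "p n"] cusp_scale_pos[OF p(2)[of n]]
      by (simp_all add: z_def)
    moreover have "\<bar>fst (z n)\<bar> = 1 \<or> \<bar>snd (z n)\<bar> = 1"
      using cusp_scale_attained[of "p n"] cusp_scale_pos[OF p(2)[of n]] by (auto simp: z_def)
    ultimately show ?thesis by linarith
  qed
  moreover have "(\<lambda>n. max \<bar>fst (z (r n))\<bar> \<bar>snd (z (r n))\<bar>) \<longlonglongrightarrow> max \<bar>fst l\<bar> \<bar>snd l\<bar>"
    by (intro tendsto_intros l1 l2)
  ultimately have "max \<bar>fst l\<bar> \<bar>snd l\<bar> = 1" by (simp add: LIMSEQ_const_iff)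
  moreover have "fst l = 0 \<and> snd l = 0"
  proof (rule no_bounded_curvature_sequence[OF U f jet b3, where p = "\<lambda>n. p (r n)"])
    show "filterlim (\<lambda>n. p (r n)) (at 0) sequentially"
      using p_lim filterlim_subseq[OF r] by (rule filterlim_compose)
  qed (use p l1 l2 in \<open>simp_all add: z_def\<close>)
  ultimately show False by simp
qed

section \<open>Branches leave the origin\<close>

lemma eventually_nonzero_at_simple_zero:
  fixes \<phi> :: "real \<Rightarrow> real"
  assumes "(\<phi> has_real_derivative D) (at 0)" "\<phi> 0 = 0" "D \<noteq> 0"
  shows "\<forall>\<^sub>F t in at 0. \<phi> t \<noteq> 0"
proof -
  have "((\<lambda>t. \<phi> t / t) \<longlongrightarrow> D) (at 0)"
    using assms by (simp add: has_field_derivative_iff)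
  then have "\<forall>\<^sub>F t in at 0. \<phi> t / t \<noteq> 0" using assms(3) by (rule tendsto_imp_eventually_ne)
  then show ?thesis by eventually_elim auto
qed

text \<open>By Rolle's theorem, zeros of \<open>\<phi>\<close> accumulating at \<open>0\<close> would produce zeros of the derivative that do so.\<close>

lemma eventually_nonzero_if_deriv_nonzero:
  fixes \<phi> :: "real \<Rightarrow> real"
  assumes \<epsilon>: "\<epsilon> > 0" "\<And>t. t \<in> {-\<epsilon><..<\<epsilon>} \<Longrightarrow> \<phi> field_differentiable at t"
    and "\<phi> 0 = 0" "\<forall>\<^sub>F t in at 0. deriv \<phi> t \<noteq> 0"
  shows "\<forall>\<^sub>F t in at 0. \<phi> t \<noteq> 0"
proof -
  obtain r where r: "r > 0" "\<And>t. t \<noteq> 0 \<Longrightarrow> \<bar>t\<bar> < r \<Longrightarrow> deriv \<phi> t \<noteq> 0"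
    using assms(4) by (auto simp: eventually_at dist_real_def)
  have der: "(\<phi> has_real_derivative deriv \<phi> t) (at t)" if "\<bar>t\<bar> < \<epsilon>" for t
    using \<epsilon>(2)[of t] that by (auto simp: field_differentiable_derivI abs_less_iff)
  have "\<phi> t \<noteq> 0" if t: "t \<noteq> 0" "\<bar>t\<bar> < min r \<epsilon>" for t
  proof
    assume z: "\<phi> t = 0"
    have "\<exists>u. min 0 t < u \<and> u < max 0 t \<and> deriv \<phi> u = 0"
    proof -
      have "\<exists>u>min 0 t. u < max 0 t \<and>
          \<phi> (max 0 t) - \<phi> (min 0 t) = (max 0 t - min 0 t) * deriv \<phi> u"
        by (rule MVT2) (use t der in \<open>auto simp: min_def max_def split: if_splits\<close>)
      then show ?thesis using z assms(3) t by (auto simp: min_def max_def split: if_splits)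
    qed
    then obtain u where u: "min 0 t < u" "u < max 0 t" "deriv \<phi> u = 0" by blast
    then have "u \<noteq> 0" "\<bar>u\<bar> < r" using t by (auto simp: min_def max_def split: if_splits)
    with r(2) u(3) show False by blast
  qed
  then show ?thesis
    using r(1) \<epsilon>(1) by (auto simp: eventually_at dist_real_def intro!: exI[of _ "min r \<epsilon>"])
qed

lemma eventually_nonzero_at_zero_order_le_2:
  fixes \<phi> :: "real \<Rightarrow> real"
  assumes \<epsilon>: "\<epsilon> > 0" "\<And>k t. t \<in> {-\<epsilon><..<\<epsilon>} \<Longrightarrow> (deriv ^^ k) \<phi> field_differentiable at t"
    and z: "\<phi> 0 = 0" and nz: "deriv \<phi> 0 \<noteq> 0 \<or> deriv \<phi> 0 = 0 \<and> (deriv ^^ 2) \<phi> 0 \<noteq> 0"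
  shows "\<forall>\<^sub>F t in at 0. \<phi> t \<noteq> 0"
proof -
  have der: "((deriv ^^ k) \<phi> has_real_derivative deriv ((deriv ^^ k) \<phi>) 0) (at 0)" for k
    using \<epsilon> by (intro field_differentiable_derivI) simp
  from nz show ?thesis
  proof
    assume "deriv \<phi> 0 \<noteq> 0"
    with der[of 0] z show ?thesis by (intro eventually_nonzero_at_simple_zero) auto
  next
    assume "deriv \<phi> 0 = 0 \<and> (deriv ^^ 2) \<phi> 0 \<noteq> 0"
    then have "\<forall>\<^sub>F t in at 0. deriv \<phi> t \<noteq> 0"
      using der[of 1] by (intro eventually_nonzero_at_simple_zero) (auto simp: eval_nat_numeral)
    moreover have "\<phi> field_differentiable at t" if "t \<in> {-\<epsilon><..<\<epsilon>}" for t
      using \<epsilon>(2)[OF that, of 0] by simp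
    ultimately show ?thesis
      using eventually_nonzero_if_deriv_nonzero[of \<epsilon> \<phi>] \<epsilon>(1) z by blast
  qed
qed

text \<open>At an ordinary cusp the first derivative vanishes but the second does not, since otherwise the
determinant in the definition would be zero. So some coordinate of the branch has a zero of order
one or two at the parameter value \<open>0\<close>, and such a zero is isolated.\<close>

lemma vertex_branch_tendsto_punctured:
  assumes "vertex_branch f \<gamma>"
  shows "filterlim \<gamma> (at 0 within vertex_set f) (at 0)"
proof -
  define x y where "x = (\<lambda>t. fst (\<gamma> t))" and "y = (\<lambda>t. snd (\<gamma> t))"
  obtain \<epsilon> where \<epsilon>: "\<epsilon> > 0" and smooth: "smooth_curve_on {-\<epsilon><..<\<epsilon>} \<gamma>"
    and sub: "\<gamma> ` {-\<epsilon><..<\<epsilon>} \<subseteq> vertex_set f"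
    using assms by (auto simp: vertex_branch_def)
  have x: "(deriv ^^ k) x field_differentiable at t"
    and y: "(deriv ^^ k) y field_differentiable at t" if "t \<in> {-\<epsilon><..<\<epsilon>}" for k t
    using smooth that by (auto simp: smooth_curve_on_def x_def y_def)
  have xy0: "x 0 = 0" "y 0 = 0" using assms by (auto simp: vertex_branch_def x_def y_def)
  have c1: "curve_deriv 1 \<gamma> 0 = (deriv x 0, deriv y 0)"
    and c2: "curve_deriv 2 \<gamma> 0 = ((deriv ^^ 2) x 0, (deriv ^^ 2) y 0)"
    by (simp_all add: curve_deriv_def x_def y_def)
  have "curve_deriv 1 \<gamma> 0 \<noteq> 0 \<or> curve_deriv 1 \<gamma> 0 = 0 \<and> curve_deriv 2 \<gamma> 0 \<noteq> 0"
    using assms by (auto simp: vertex_branch_def ordinary_cusp_at_def)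
  then have "(deriv x 0 \<noteq> 0 \<or> deriv x 0 = 0 \<and> (deriv ^^ 2) x 0 \<noteq> 0) \<or>
             (deriv y 0 \<noteq> 0 \<or> deriv y 0 = 0 \<and> (deriv ^^ 2) y 0 \<noteq> 0)"
    unfolding c1 c2 zero_prod_def by auto
  then have "(\<forall>\<^sub>F t in at 0. x t \<noteq> 0) \<or> (\<forall>\<^sub>F t in at 0. y t \<noteq> 0)"
    using eventually_nonzero_at_zero_order_le_2[OF \<epsilon> x xy0(1)]
      eventually_nonzero_at_zero_order_le_2[OF \<epsilon> y xy0(2)] by blast
  then have ne: "\<forall>\<^sub>F t in at 0. \<gamma> t \<noteq> 0"
    by (auto simp: x_def y_def elim!: eventually_mono)
  have "\<forall>\<^sub>F t in at 0. t \<in> {-\<epsilon><..<\<epsilon>}"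
    using \<epsilon> by (intro eventually_at_in_open') auto
  then have mem: "\<forall>\<^sub>F t in at 0. \<gamma> t \<in> vertex_set f"
    by eventually_elim (use sub in blast)
  have "isCont x 0" "isCont y 0"
    using x[of 0 0] y[of 0 0] \<epsilon> by (auto intro: field_differentiable_imp_continuous_at)
  then have "((\<lambda>t. (x t, y t)) \<longlongrightarrow> (0, 0)) (at 0)"
    using xy0 by (intro tendsto_Pair) (auto simp: isCont_def)
  then have "(\<gamma> \<longlongrightarrow> 0) (at 0)" by (simp add: x_def y_def zero_prod_def)
  with ne mem show ?thesis by (simp add: filterlim_at eventually_conj_iff)
qed

theorem proposition5p3:
  fixes f :: "real \<times> real \<Rightarrow> real" and b0 b1 b2 b3 :: real
  assumes smooth: "smooth_near f (0, 0)"
    and jet: "(\<lambda>(x, y). f (x, y) - (x^2 + b0 * x^3 + b1 * x^2 * y + b2 * x * y^2 + b3 * y^3))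
                \<in> O[at (0, 0)](\<lambda>q. norm q ^ 4)"
    and b3: "b3 \<noteq> 0"
  shows "(\<forall>\<gamma>. vertex_branch f \<gamma> \<longrightarrow>
            filterlim (\<lambda>t. abs_level_curvature f (\<gamma> t)) at_top (at 0)) \<and>
         filterlim (abs_level_curvature f) at_top (at (0, 0) within vertex_set f)"
proof -
  obtain U where "open U" "0 \<in> U" "C_inf_on U f"
    using smooth by (auto simp: smooth_near_def C_inf_on_def zero_prod_def)
  from curvature_at_top_within_vertex_set[OF this jet[folded zero_prod_def] b3]
  have lim: "filterlim (abs_level_curvature f) at_top (at 0 within vertex_set f)" .
  then show ?thesis
    using filterlim_compose[OF lim vertex_branch_tendsto_punctured]
    by (simp add: zero_prod_def)
qed

end
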